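(* Define $$a(n) = \frac{|P_n|^2 + |N_n|^2}{5}, \qquad n \ge 0,$$ where $|U|^2 = x^2 + y^2$ denotes the squared Euclidean norm of $U = (x,y)$. Then $a(n)$ is an integer for every integer $n \ge 0$, given in closed form by $$a(n) = 2^{n+1} + 1 - 2\operatorname{Re}\bigl((1 + i)^n\bigr).$$
   Context: The sequences $\{P_n\}_{n\ge 0}$ (positive orbit) and $\{N_n\}_{n\ge 0}$ (negative orbit) of points of $\mathbb{Z}^2$ are defined by the recurrences $$P_{n+1} = A P_n + v,\quad P_0 = (0,0), \qquad N_{n+1} = A N_n,\quad N_0 = (-1,2),$$ where $A = \begin{pmatrix} 1 & -1 \\ 1 & 1 \end{pmatrix}$ and $v = (2,1)$, with points treated as column vectors. Identifying $(x,y)\in\mathbb{R}^2$ with $x+iy\in\mathbb{C}$, these read $P_{n+1} = (1+i)P_n + (2+i)$ with $P_0 = 0$, and $N_{n+1} = (1+i)N_n$ with $N_0 = -1+2i$. *)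

theory Defs
  imports "HOL-Analysis.Analysis"
begin

definition A :: "int ^ 2 ^ 2" where
  "A = vector [vector [1, -1], vector [1, 1]]"

definition v :: "int ^ 2" where
  "v = vector [2, 1]"

primrec P :: "nat \<Rightarrow> int ^ 2" where
  "P 0 = vector [0, 0]"
| "P (Suc n) = A *v P n + v"

primrec N :: "nat \<Rightarrow> int ^ 2" where
  "N 0 = vector [-1, 2]"
| "N (Suc n) = A *v N n"

definition sq_norm :: "int ^ 2 \<Rightarrow> int" where
  "sq_norm U = (U $ 1)\<^sup>2 + (U $ 2)\<^sup>2"

lemma sq_norm_eq_norm:
  "real_of_int (sq_norm U) = (norm (\<chi> i. real_of_int (U $ i)))\<^sup>2"
  by (simp add: sq_norm_def norm_vec_def L2_set_def sum_2)

definition a :: "nat \<Rightarrow> real" where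
  "a n = (real_of_int (sq_norm (P n)) + real_of_int (sq_norm (N n))) / 5"

text \<open>The quotient is formed in the reals, not by integer division, so that
  integrality of \<^term>\<open>a n\<close> is a genuine claim.\<close>

end

theory Submission imports Defs
begin

text \<open>
  Identify \<open>(x, y)\<close> with \<open>x + \<i> y\<close>. The matrix acts as multiplication by \<open>w = 1 + \<i>\<close>, so both
  orbits have closed forms. The affine map \<open>z \<mapsto> w z + (2 + \<i>)\<close> of the positive orbit has the
  fixed point \<open>- (2 + \<i>) / \<i> = - (1 - 2 \<i>)\<close>, and the negative orbit starts at this very point.
  Hence the points of the two orbits are \<open>(1 - 2 \<i>) (w ^ n - 1)\<close> and \<open>- (1 - 2 \<i>) w ^ n\<close>.

  The common factor \<open>1 - 2 \<i>\<close> has squared modulus 5, which is the denominator of \<^term>\<open>a n\<close>.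
  What remains is \<open>\<bar>w ^ n - 1\<bar>\<^sup>2 + \<bar>w ^ n\<bar>\<^sup>2\<close>, and expanding the first square with
  \<open>\<bar>w ^ n\<bar>\<^sup>2 = 2 ^ n\<close> gives the closed form. Integrality follows because \<open>w ^ n\<close> is a Gaussian
  integer.
\<close>

definition complex_of_point :: "int ^ 2 \<Rightarrow> complex" where
  "complex_of_point U = Complex (of_int (U $ 1)) (of_int (U $ 2))"

lemma sq_norm_eq_cmod:
  "real_of_int (sq_norm U) = (cmod (complex_of_point U))\<^sup>2"
  by (simp add: sq_norm_def complex_of_point_def cmod_power2)

lemma complex_of_point_add:
  "complex_of_point (U + V) = complex_of_point U + complex_of_point V"
  by (simp add: complex_of_point_def complex_eq_iff)

lemma complex_of_point_A:
  "complex_of_point (A *v U) = (1 + \<i>) * complex_of_point U"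
  by (simp add: complex_of_point_def complex_eq_iff A_def matrix_vector_mult_def sum_2)

lemma complex_of_point_P:
  "complex_of_point (P n) = (1 - 2 * \<i>) * ((1 + \<i>) ^ n - 1)"
proof (induction n)
  case 0
  show ?case by (simp add: complex_of_point_def complex_eq_iff)
next
  case (Suc n)
  have "complex_of_point v = 2 + \<i>"
    by (simp add: complex_of_point_def complex_eq_iff v_def)
  with Suc have "complex_of_point (P (Suc n)) =
      (1 + \<i>) * ((1 - 2 * \<i>) * ((1 + \<i>) ^ n - 1)) + (2 + \<i>)"
    by (simp add: complex_of_point_add complex_of_point_A)
  \<comment> \<open>The induction closes because \<open>- (1 - 2 \<i>)\<close> is the fixed point of \<open>z \<mapsto> (1 + \<i>) z + (2 + \<i>)\<close>.\<close>
  also have "\<dots> = (1 - 2 * \<i>) * ((1 + \<i>) ^ Suc n - 1)"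
    by (simp add: algebra_simps)
  finally show ?case .
qed

lemma complex_of_point_N:
  "complex_of_point (N n) = - (1 - 2 * \<i>) * (1 + \<i>) ^ n"
proof (induction n)
  case 0
  show ?case by (simp add: complex_of_point_def complex_eq_iff)
next
  case (Suc n)
  then show ?case by (simp add: complex_of_point_A del: mult_minus_left minus_diff_eq)
qed

lemma cmod_sq_one_plus_i_power: "(cmod ((1 + \<i>) ^ n))\<^sup>2 = 2 ^ n"
proof -
  have "(cmod (1 + \<i>))\<^sup>2 = 2"
    by (simp add: cmod_power2)
  then show ?thesis
    by (metis norm_power power_mult mult.commute)
qed

lemma cmod_sq_diff_one: "(cmod (z - 1))\<^sup>2 = (cmod z)\<^sup>2 + 1 - 2 * Re z"
  unfolding cmod_power2 by (simp add: power2_eq_square algebra_simps)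

text \<open>
  Multiplication by \<open>1 + \<i>\<close> mixes real and imaginary parts, so the induction needs both.
\<close>

lemma one_plus_i_power_Gaussian_integer:
  "Re ((1 + \<i>) ^ n) \<in> \<int> \<and> Im ((1 + \<i>) ^ n) \<in> \<int>"
  by (induction n) auto

theorem theorem5p2:
  fixes n :: nat
  shows "a n \<in> \<int> \<and> a n = 2 ^ (n + 1) + 1 - 2 * Re ((1 + \<i>) ^ n)"
proof -
  define z where "z = (1 + \<i>) ^ n"
  have five: "(cmod (1 - 2 * \<i>))\<^sup>2 = 5"
    by (simp add: cmod_power2)
  have "real_of_int (sq_norm (P n)) = 5 * (cmod (z - 1))\<^sup>2"
    by (simp only: sq_norm_eq_cmod complex_of_point_P norm_mult power_mult_distrib five z_def)
  moreover have "real_of_int (sq_norm (N n)) = 5 * (cmod z)\<^sup>2"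
    by (simp only: sq_norm_eq_cmod complex_of_point_N norm_mult norm_minus_cancel
        power_mult_distrib five z_def)
  ultimately have "a n = (cmod (z - 1))\<^sup>2 + (cmod z)\<^sup>2"
    by (simp add: a_def)
  also have "\<dots> = 2 ^ (n + 1) + 1 - 2 * Re z"
    using cmod_sq_one_plus_i_power[of n] by (simp add: cmod_sq_diff_one z_def)
  finally have closed: "a n = 2 ^ (n + 1) + 1 - 2 * Re z" .
  moreover have "Re z \<in> \<int>"
    using one_plus_i_power_Gaussian_integer[of n] by (simp add: z_def)
  ultimately have "a n \<in> \<int>"
    by simp
  with closed show ?thesis
    by (simp add: z_def)
qed

end
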